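(* If $G=(X,Y,E)$ is a complete bipartite graph, then the minimum imbalance of $G$ is $$I(G)=|X|\cdot|Y|+(|X|\bmod 2)\cdot(|Y|\bmod 2).$$
   Context: All graphs are finite, simple, undirected and connected. An ordering of a finite set $V$ is a bijection $\sigma:V\to\{1,\dots,|V|\}$; $u<_\sigma v$ means $\sigma(u)<\sigma(v)$. For a graph $G=(V,E)$ and ordering $\sigma$, $I(v,\sigma,G)=\big|\,|\{u\in N(v): u<_\sigma v\}|-|\{u\in N(v): u>_\sigma v\}|\,\big|$ ($N(v)$ the neighbourhood of $v$), $I(\sigma,G)=\sum_{v\in V}I(v,\sigma,G)$, and $I(G)=\min_\sigma I(\sigma,G)$ over all orderings of $V$. *)

theory Defs
  imports "Graph_Theory.Graph_Theory"
begin

text \<open>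
  Finite simple undirected graphs are rendered by the library locale \<^locale>\<open>graph\<close>: finite
  digraphs without loops or parallel arcs whose adjacency relation is symmetric, so that each
  undirected edge corresponds to a pair of opposite arcs.
\<close>

definition neighbourhood :: "('a, 'b) pre_digraph \<Rightarrow> 'a \<Rightarrow> 'a set" where
  "neighbourhood G v = {u \<in> verts G. v \<rightarrow>\<^bsub>G\<^esub> u}"

definition complete_bipartite_graph ::
    "('a, 'b) pre_digraph \<Rightarrow> 'a set \<Rightarrow> 'a set \<Rightarrow> bool" where
  "complete_bipartite_graph G X Y \<longleftrightarrow>
     graph G \<and> verts G = X \<union> Y \<and> X \<inter> Y = {} \<and> arcs_ends G = X \<times> Y \<union> Y \<times> X"

definition is_ordering :: "'a set \<Rightarrow> ('a \<Rightarrow> nat) \<Rightarrow> bool" where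
  "is_ordering V \<sigma> \<longleftrightarrow> bij_betw \<sigma> V {1..card V}"

definition vertex_imbalance :: "'a \<Rightarrow> ('a \<Rightarrow> nat) \<Rightarrow> ('a, 'b) pre_digraph \<Rightarrow> nat" where
  "vertex_imbalance v \<sigma> G =
     nat \<bar>int (card {u \<in> neighbourhood G v. \<sigma> u < \<sigma> v})
          - int (card {u \<in> neighbourhood G v. \<sigma> u > \<sigma> v})\<bar>"

definition ordering_imbalance :: "('a \<Rightarrow> nat) \<Rightarrow> ('a, 'b) pre_digraph \<Rightarrow> nat" where
  "ordering_imbalance \<sigma> G = (\<Sum>v\<in>verts G. vertex_imbalance v \<sigma> G)"

definition imbalance :: "('a, 'b) pre_digraph \<Rightarrow> nat" where
  "imbalance G = Min {ordering_imbalance \<sigma> G | \<sigma>. is_ordering (verts G) \<sigma>}"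

text \<open>
  Orderings are total functions with arbitrary values outside the vertex set, so there may be
  infinitely many of them; the set of attained imbalances is nevertheless finite and nonempty,
  so the minimum above is a genuine one.
\<close>

lemma (in graph) finite_ordering_imbalances:
  "finite {ordering_imbalance \<sigma> G | \<sigma>. is_ordering (verts G) \<sigma>}"
proof (rule finite_subset)
  have "vertex_imbalance v \<sigma> G \<le> card (verts G)" for v \<sigma>
  proof -
    have "card {u \<in> neighbourhood G v. \<sigma> u < \<sigma> v} \<le> card (verts G)"
      "card {u \<in> neighbourhood G v. \<sigma> u > \<sigma> v} \<le> card (verts G)"
      by (auto simp: neighbourhood_def intro!: card_mono)
    then show ?thesis
      by (simp add: vertex_imbalance_def)
  qed
  then have "ordering_imbalance \<sigma> G \<le> card (verts G) * card (verts G)" for \<sigma>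
    unfolding ordering_imbalance_def
    using sum_bounded_above[of "verts G" "\<lambda>v. vertex_imbalance v \<sigma> G" "card (verts G)"] by simp
  then show "{ordering_imbalance \<sigma> G | \<sigma>. is_ordering (verts G) \<sigma>}
      \<subseteq> {..card (verts G) * card (verts G)}"
    by auto
qed simp

lemma (in graph) ordering_imbalances_nonempty:
  "{ordering_imbalance \<sigma> G | \<sigma>. is_ordering (verts G) \<sigma>} \<noteq> {}"
proof -
  obtain \<sigma> where "bij_betw \<sigma> (verts G) {1..card (verts G)}"
    using finite_same_card_bij[of "verts G" "{1..card (verts G)}"] by auto
  then show ?thesis
    unfolding is_ordering_def by blast
qed

end

theory Submission
  imports Defs
begin

text \<open>
  Let \<open>m = |X|\<close>, \<open>n = |Y|\<close>, and let \<open>A i\<close>, \<open>B i\<close> count the members of \<open>X\<close>, \<open>Y\<close> among the first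
  \<open>i\<close> vertices of an ordering. Put \<open>f i = (2 A i - m) (2 B i - n)\<close>. The vertex at position \<open>i + 1\<close>
  has imbalance \<open>|f (i + 1) - f i| / 2\<close>, so the imbalance of the ordering is half the total variation
  of \<open>f\<close>, which starts and ends at \<open>m n\<close>. The first time one of the two factors stops being
  negative, \<open>f\<close> is at most \<open>0\<close>, and at most \<open>-1\<close> if \<open>m\<close> and \<open>n\<close> are both odd; this gives the lower
  bound. It is attained by placing half of \<open>X\<close> first, half of \<open>X\<close> last, and in between \<open>Y\<close> with the
  possible remaining vertex of \<open>X\<close> in its middle.
\<close>

lemma abs_diff_le_sum_abs_diff:
  fixes f :: "nat \<Rightarrow> int"
  assumes "a \<le> b"
  shows "\<bar>f b - f a\<bar> \<le> (\<Sum>i\<in>{a<..b}. \<bar>f i - f (i - 1)\<bar>)"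
  using assms
proof (induction b rule: dec_induct)
  case (step b)
  have "{a<..Suc b} = insert (Suc b) {a<..b}"
    using step.hyps by auto
  with step.IH show ?case by simp
qed simp

lemma ex_ordering_refining_key:
  fixes key :: "'a \<Rightarrow> nat"
  assumes "finite V"
  obtains \<sigma> where "is_ordering V \<sigma>"
    and "\<And>u v. u \<in> V \<Longrightarrow> v \<in> V \<Longrightarrow> key u < key v \<Longrightarrow> \<sigma> u < \<sigma> v"
proof -
  obtain h where h: "bij_betw h V {0..<card V}"
    using ex_bij_betw_finite_nat[OF assms] by blast
  define k where "k v = key v * card V + h v" for v
  define \<sigma> where "\<sigma> v = card {u \<in> V. k u \<le> k v}" for v
  have h_less: "h v < card V" if "v \<in> V" for v
    using h that by (auto simp: bij_betw_def)
  have k_div: "k v div card V = key v" and k_mod: "k v mod card V = h v" if "v \<in> V" for v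
    using h_less[OF that] by (auto simp: k_def)
  have inj_k: "inj_on k V"
    using h k_mod unfolding bij_betw_def inj_on_def by metis
  have mono: "\<sigma> u < \<sigma> v" if "u \<in> V" "v \<in> V" "k u < k v" for u v
  proof -
    have "v \<in> {w \<in> V. k w \<le> k v} - {w \<in> V. k w \<le> k u}"
      using that by simp
    moreover have "{w \<in> V. k w \<le> k u} \<subseteq> {w \<in> V. k w \<le> k v}"
      using that by auto
    ultimately have "{w \<in> V. k w \<le> k u} \<subset> {w \<in> V. k w \<le> k v}"
      by blast
    then show ?thesis
      unfolding \<sigma>_def using assms by (intro psubset_card_mono) simp_all
  qed
  have "inj_on \<sigma> V"
    using inj_k mono unfolding inj_on_def by (metis less_irrefl linorder_neqE_nat)
  moreover have "\<sigma> ` V \<subseteq> {1..card V}"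
  proof
    fix i assume "i \<in> \<sigma> ` V"
    then obtain v where v: "v \<in> V" "i = \<sigma> v" by auto
    have "\<sigma> v > 0" using v assms by (auto simp: \<sigma>_def card_gt_0_iff)
    moreover have "\<sigma> v \<le> card V" unfolding \<sigma>_def using assms by (auto intro: card_mono)
    ultimately show "i \<in> {1..card V}" using v by simp
  qed
  ultimately have "is_ordering V \<sigma>"
    unfolding is_ordering_def bij_betw_def
    by (simp add: card_image card_subset_eq)
  moreover have "\<sigma> u < \<sigma> v" if "u \<in> V" "v \<in> V" "key u < key v" for u v
  proof (rule mono)
    show "k u < k v"
      using k_div that by (metis div_le_mono not_less)
  qed (use that in auto)
  ultimately show ?thesis by (rule that)
qed

lemma complete_bipartite_graph_commute:
  "complete_bipartite_graph G X Y \<Longrightarrow> complete_bipartite_graph G Y X"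
  by (auto simp: complete_bipartite_graph_def)

lemma complete_bipartite_graph_finite:
  assumes "complete_bipartite_graph G X Y"
  shows "finite X" "finite Y"
proof -
  interpret graph G using assms by (simp add: complete_bipartite_graph_def)
  have "finite (X \<union> Y)"
    using finite_verts assms by (metis complete_bipartite_graph_def)
  then show "finite X" "finite Y" by simp_all
qed

lemma neighbourhood_complete_bipartite:
  assumes "complete_bipartite_graph G X Y" "v \<in> X"
  shows "neighbourhood G v = Y"
  using assms by (auto simp: neighbourhood_def complete_bipartite_graph_def)

lemma vertex_imbalance_complete_bipartite:
  assumes G: "complete_bipartite_graph G X Y" and "v \<in> X" and "inj_on \<sigma> (verts G)"
  shows "int (vertex_imbalance v \<sigma> G) = \<bar>2 * int (card {u \<in> Y. \<sigma> u < \<sigma> v}) - int (card Y)\<bar>"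
proof -
  have "\<sigma> u \<noteq> \<sigma> v" if "u \<in> Y" for u
    using assms that by (auto simp: complete_bipartite_graph_def inj_on_def)
  then have Y: "Y = {u \<in> Y. \<sigma> u < \<sigma> v} \<union> {u \<in> Y. \<sigma> u > \<sigma> v}"
    by (auto simp: neq_iff)
  have "card Y = card {u \<in> Y. \<sigma> u < \<sigma> v} + card {u \<in> Y. \<sigma> u > \<sigma> v}"
    using complete_bipartite_graph_finite(2)[OF G] by (subst Y, subst card_Un_disjoint) auto
  then show ?thesis
    by (simp add: vertex_imbalance_def neighbourhood_complete_bipartite[OF assms(1,2)])
qed

lemma card_le_Suc_eq:
  assumes "finite S" "inj_on \<sigma> S" "v \<in> S" "\<sigma> v = Suc i"
  shows "card {u \<in> S. \<sigma> u \<le> Suc i} = Suc (card {u \<in> S. \<sigma> u \<le> i})"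
proof -
  have "{u \<in> S. \<sigma> u \<le> Suc i} = insert v {u \<in> S. \<sigma> u \<le> i}"
    using assms by (auto simp: inj_on_def le_Suc_eq)
  then show ?thesis using assms by simp
qed

lemma card_le_Suc_eq_of_notin_image:
  assumes "Suc i \<notin> \<sigma> ` S"
  shows "card {u \<in> S. \<sigma> u \<le> Suc i} = card {u \<in> S. \<sigma> u \<le> i}"
  using assms by (intro arg_cong[where f = card]) (force simp: le_Suc_eq)

lemma ordering_imbalance_lower_bound:
  assumes G: "complete_bipartite_graph G X Y" and \<sigma>: "is_ordering (verts G) \<sigma>"
  shows "card X * card Y + (card X mod 2) * (card Y mod 2) \<le> ordering_imbalance \<sigma> G"
proof -
  note fin = complete_bipartite_graph_finite[OF G]
  have V: "verts G = X \<union> Y" and disj: "X \<inter> Y = {}"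
    using G by (auto simp: complete_bipartite_graph_def)
  define N where "N = card (verts G)"
  have bij: "bij_betw \<sigma> (verts G) {1..N}" and inj: "inj_on \<sigma> (verts G)"
    using \<sigma> by (auto simp: is_ordering_def N_def bij_betw_def)
  have inj_X: "inj_on \<sigma> X" and inj_Y: "inj_on \<sigma> Y"
    using inj V by (auto simp: inj_on_Un)
  have range: "1 \<le> \<sigma> v" "\<sigma> v \<le> N" if "v \<in> X \<union> Y" for v
    using bij that V by (auto simp: bij_betw_def)
  define A B where "A i = card {u \<in> X. \<sigma> u \<le> i}" and "B i = card {u \<in> Y. \<sigma> u \<le> i}" for i
  define p q where "p i = 2 * int (A i) - int (card X)" and "q i = 2 * int (B i) - int (card Y)" for i
  define f where "f i = p i * q i" for i
  have p0: "p 0 = - int (card X)" and q0: "q 0 = - int (card Y)"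
  proof -
    have "{u \<in> X. \<sigma> u \<le> 0} = {}" "{u \<in> Y. \<sigma> u \<le> 0} = {}" using range(1) by force+
    then show "p 0 = - int (card X)" "q 0 = - int (card Y)"
      unfolding p_def q_def A_def B_def by (metis card.empty diff_0 mult_zero_right of_nat_0)+
  qed
  have pN: "p N = int (card X)" and qN: "q N = int (card Y)"
  proof -
    have "{u \<in> X. \<sigma> u \<le> N} = X" "{u \<in> Y. \<sigma> u \<le> N} = Y" using range(2) by auto
    then show "p N = int (card X)" "q N = int (card Y)"
      by (simp_all add: p_def q_def A_def B_def)
  qed
  have ne: "\<sigma> u \<noteq> \<sigma> v" if "u \<in> X" "v \<in> Y" for u v
    using inj V disj that unfolding inj_on_def by blast
  have step_X: "p (Suc i) = p i + 2 \<and> q (Suc i) = q i" if "v \<in> X" "\<sigma> v = Suc i" for v i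
  proof -
    have "Suc i \<notin> \<sigma> ` Y"
      using ne[OF that(1)] that(2) by (metis imageE)
    with card_le_Suc_eq[OF fin(1) inj_X that] show ?thesis
      by (simp add: p_def q_def A_def B_def card_le_Suc_eq_of_notin_image)
  qed
  have step_Y: "p (Suc i) = p i \<and> q (Suc i) = q i + 2" if "v \<in> Y" "\<sigma> v = Suc i" for v i
  proof -
    have "Suc i \<notin> \<sigma> ` X"
      using ne[OF _ that(1)] that(2) by (metis imageE)
    with card_le_Suc_eq[OF fin(2) inj_Y that] show ?thesis
      by (simp add: p_def q_def A_def B_def card_le_Suc_eq_of_notin_image)
  qed
  have variation: "2 * int (vertex_imbalance v \<sigma> G) = \<bar>f (\<sigma> v) - f (\<sigma> v - 1)\<bar>"
    if v: "v \<in> verts G" for v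
  proof -
    obtain i where i: "\<sigma> v = Suc i"
      using range(1)[of v] v V by (cases "\<sigma> v") auto
    show ?thesis
    proof (cases "v \<in> X")
      case True
      have "f (Suc i) - f i = 2 * q i"
        using step_X[OF True i] by (simp add: f_def algebra_simps)
      moreover have "int (vertex_imbalance v \<sigma> G) = \<bar>q i\<bar>"
        using vertex_imbalance_complete_bipartite[OF G True inj]
        by (simp add: i q_def B_def less_Suc_eq_le)
      ultimately show ?thesis by (simp add: i abs_mult)
    next
      case False
      then have Y: "v \<in> Y" using v V by auto
      have "f (Suc i) - f i = 2 * p i"
        using step_Y[OF Y i] by (simp add: f_def algebra_simps)
      moreover have "int (vertex_imbalance v \<sigma> G) = \<bar>p i\<bar>"
        using vertex_imbalance_complete_bipartite[OF complete_bipartite_graph_commute[OF G] Y inj]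
        by (simp add: i p_def A_def less_Suc_eq_le)
      ultimately show ?thesis by (simp add: i abs_mult)
    qed
  qed
  have "2 * int (ordering_imbalance \<sigma> G) = (\<Sum>v\<in>verts G. \<bar>f (\<sigma> v) - f (\<sigma> v - 1)\<bar>)"
    unfolding ordering_imbalance_def by (simp add: sum_distrib_left variation)
  also have "\<dots> = (\<Sum>i\<in>{1..N}. \<bar>f i - f (i - 1)\<bar>)"
    by (rule sum.reindex_bij_betw[OF bij])
  also have "{1..N} = {0<..N}" by auto
  finally have total: "2 * int (ordering_imbalance \<sigma> G) = (\<Sum>i\<in>{0<..N}. \<bar>f i - f (i - 1)\<bar>)" .
  obtain k where k: "k \<le> N" "f k \<le> - int ((card X mod 2) * (card Y mod 2))"
  proof -
    define k where "k = (LEAST i. p i \<ge> 0 \<or> q i \<ge> 0)"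
    have PN: "p N \<ge> 0 \<or> q N \<ge> 0" by (simp add: pN)
    then have k: "p k \<ge> 0 \<or> q k \<ge> 0" and "k \<le> N"
      unfolding k_def by (rule LeastI, rule Least_le)
    have parity: "p k \<noteq> 0" if "odd (card X)"
      using that unfolding p_def by presburger
    have parity': "q k \<noteq> 0" if "odd (card Y)"
      using that unfolding q_def by presburger
    have sign: "p k \<ge> 0 \<and> q k \<le> 0 \<or> p k \<le> 0 \<and> q k \<ge> 0"
    proof (cases k)
      case 0
      then show ?thesis using k p0 q0 by auto
    next
      case (Suc i)
      then have neg: "p i < 0" "q i < 0"
        using not_less_Least[of i "\<lambda>i. p i \<ge> 0 \<or> q i \<ge> 0"] by (auto simp: k_def)
      have "Suc i \<in> \<sigma> ` verts G"
        using bij \<open>k \<le> N\<close> Suc by (auto simp: bij_betw_def)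
      then obtain v where "v \<in> X \<union> Y" "\<sigma> v = Suc i" using V by (metis imageE)
      then show ?thesis
        using step_X[of v i] step_Y[of v i] neg k Suc by auto
    qed
    have "f k \<le> - int ((card X mod 2) * (card Y mod 2))"
    proof (cases "odd (card X) \<and> odd (card Y)")
      case True
      have "p k * q k < 0"
        using parity parity' sign True by (auto simp: mult_less_0_iff)
      then show ?thesis using True by (simp add: f_def odd_iff_mod_2_eq_one)
    next
      case False
      then have "(card X mod 2) * (card Y mod 2) = 0" by auto
      then show ?thesis using sign by (auto simp: f_def mult_le_0_iff)
    qed
    with \<open>k \<le> N\<close> show ?thesis by (rule that)
  qed
  have "{0<..N} = {0<..k} \<union> {k<..N}" using k by auto
  then have "(\<Sum>i\<in>{0<..N}. \<bar>f i - f (i - 1)\<bar>)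
      = (\<Sum>i\<in>{0<..k}. \<bar>f i - f (i - 1)\<bar>) + (\<Sum>i\<in>{k<..N}. \<bar>f i - f (i - 1)\<bar>)"
    by (simp add: sum.union_disjoint Int_def)
  with total have "2 * int (ordering_imbalance \<sigma> G) \<ge> \<bar>f k - f 0\<bar> + \<bar>f N - f k\<bar>"
    using abs_diff_le_sum_abs_diff[of 0 k f] abs_diff_le_sum_abs_diff[OF k(1), of f] by simp
  moreover have "f 0 = int (card X * card Y)" "f N = int (card X * card Y)"
    by (simp_all add: f_def p0 q0 pN qN)
  ultimately have "int (card X * card Y + (card X mod 2) * (card Y mod 2))
      \<le> int (ordering_imbalance \<sigma> G)"
    using k(2) by linarith
  then show ?thesis by (simp only: of_nat_le_iff)
qed

lemma ordering_imbalance_attained: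
  assumes G: "complete_bipartite_graph G X Y"
  obtains \<sigma> where "is_ordering (verts G) \<sigma>"
    and "ordering_imbalance \<sigma> G = card X * card Y + (card X mod 2) * (card Y mod 2)"
proof -
  note fin = complete_bipartite_graph_finite[OF G]
  have V: "verts G = X \<union> Y" and disj: "X \<inter> Y = {}"
    using G by (auto simp: complete_bipartite_graph_def)
  define m n where "m = card X" and "n = card Y"
  obtain X1 where X1: "X1 \<subseteq> X" "card X1 = m div 2"
    using obtain_subset_with_card_n[of "m div 2" X] by (auto simp: m_def)
  have "m div 2 \<le> card (X - X1)"
    using X1 fin by (simp add: card_Diff_subset finite_subset m_def)
  then obtain X2 where X2: "X2 \<subseteq> X - X1" "card X2 = m div 2"
    using obtain_subset_with_card_n by metis
  obtain Y1 where Y1: "Y1 \<subseteq> Y" "card Y1 = n div 2"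
    using obtain_subset_with_card_n[of "n div 2" Y] by (auto simp: n_def)
  define X0 where "X0 = X - X1 - X2"
  have finX: "finite X1" "finite X2" "finite X0"
    using X1 X2 fin by (auto simp: X0_def intro: finite_subset)
  have X: "X = X1 \<union> X2 \<union> X0" and disjX: "X1 \<inter> X2 = {}" "(X1 \<union> X2) \<inter> X0 = {}"
    using X1 X2 by (auto simp: X0_def)
  have "m = card X1 + card X2 + card X0"
    unfolding m_def by (subst X) (use disjX finX in \<open>simp add: card_Un_disjoint\<close>)
  then have X0: "card X0 = m mod 2"
    using X1 X2 by presburger
  define key :: "'a \<Rightarrow> nat" where "key v = (if v \<in> X1 then 0 else if v \<in> Y1 then 1
    else if v \<in> X0 then 2 else if v \<in> Y then 3 else 4)" for v
  have key_X1: "key v = 0" if "v \<in> X1" for v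
    using that by (simp add: key_def)
  have key_X2: "key v = 4" if "v \<in> X2" for v
    using that X1 X2 Y1 disj by (auto simp: key_def X0_def)
  have key_X0: "key v = 2" if "v \<in> X0" for v
    using that X1 X2 Y1 disj by (auto simp: key_def X0_def)
  have key_Y1: "key v = 1" if "v \<in> Y1" for v
    using that X1 Y1 disj by (auto simp: key_def)
  have key_Y2: "key v = 3" if "v \<in> Y - Y1" for v
    using that X1 disj by (auto simp: key_def X0_def)
  have "finite (verts G)" using V fin by simp
  then obtain \<sigma> where \<sigma>: "is_ordering (verts G) \<sigma>"
    and refines: "\<And>u v. u \<in> verts G \<Longrightarrow> v \<in> verts G \<Longrightarrow> key u < key v \<Longrightarrow> \<sigma> u < \<sigma> v"
    using ex_ordering_refining_key[where key = key] by blast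
  have inj: "inj_on \<sigma> (verts G)"
    using \<sigma> by (auto simp: is_ordering_def bij_betw_def)
  have iff: "\<sigma> u < \<sigma> v \<longleftrightarrow> key u < key v"
    if "u \<in> verts G" "v \<in> verts G" "key u \<noteq> key v" for u v
    using refines[of u v] refines[of v u] that by (meson less_asym nat_neq_iff)
  have key_Y: "key u = (if u \<in> Y1 then 1 else 3)" if "u \<in> Y" for u
    using key_Y1 key_Y2 that by auto
  have key_X: "key u = (if u \<in> X1 then 0 else if u \<in> X2 then 4 else 2)" if "u \<in> X" for u
    using key_X1 key_X2 key_X0 that X by auto
  have before_X: "{u \<in> Y. \<sigma> u < \<sigma> v} = {u \<in> Y. key u < key v}" if "v \<in> X" for v
    using iff[of _ v] key_Y key_X[OF that] that V by (auto split: if_splits)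
  have before_Y: "{u \<in> X. \<sigma> u < \<sigma> v} = {u \<in> X. key u < key v}" if "v \<in> Y" for v
    using iff[of _ v] key_X key_Y[OF that] that V by (auto split: if_splits)
  have imb_X: "int (vertex_imbalance v \<sigma> G) = \<bar>2 * int (card S) - int n\<bar>"
    if "v \<in> X" "{u \<in> Y. key u < key v} = S" for v S
    using vertex_imbalance_complete_bipartite[OF G that(1) inj]
    unfolding before_X[OF that(1)] that(2) n_def .
  have imb_X1: "vertex_imbalance v \<sigma> G = n" if "v \<in> X1" for v
  proof -
    have "{u \<in> Y. key u < key v} = {}" using key_X1[OF that] by simp
    from imb_X[OF _ this] show ?thesis using that X1 by auto
  qed
  have imb_X2: "vertex_imbalance v \<sigma> G = n" if "v \<in> X2" for v
  proof -
    have "{u \<in> Y. key u < key v} = Y" using key_X2[OF that] key_Y by auto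
    from imb_X[OF _ this] show ?thesis using that X2 by (auto simp: n_def)
  qed
  have imb_X0: "vertex_imbalance v \<sigma> G = n mod 2" if "v \<in> X0" for v
  proof -
    have "{u \<in> Y. key u < key v} = Y1"
      using key_X0[OF that] key_Y Y1 by (auto split: if_splits)
    from imb_X[OF _ this] have "int (vertex_imbalance v \<sigma> G) = \<bar>2 * int (n div 2) - int n\<bar>"
      using that X Y1 by simp
    then show ?thesis by presburger
  qed
  have imb_Y: "vertex_imbalance v \<sigma> G = m mod 2" if "v \<in> Y" for v
  proof -
    have "{u \<in> X. key u < key v} = X1 \<union> (if v \<in> Y1 then {} else X0)"
      using key_Y[OF that] key_X X disjX by (auto split: if_splits)
    moreover have "card (X1 \<union> X0) = m div 2 + m mod 2"
      using disjX finX X1 X0 by (subst card_Un_disjoint) auto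
    ultimately have "card {u \<in> X. \<sigma> u < \<sigma> v} = m div 2 + (if v \<in> Y1 then 0 else m mod 2)"
      using before_Y[OF that] X1 by simp
    with vertex_imbalance_complete_bipartite[OF complete_bipartite_graph_commute[OF G] that inj]
    have "int (vertex_imbalance v \<sigma> G)
        = \<bar>2 * int (m div 2 + (if v \<in> Y1 then 0 else m mod 2)) - int m\<bar>"
      by (simp only: m_def)
    then show ?thesis by (cases "v \<in> Y1") (simp_all, presburger+)
  qed
  have "ordering_imbalance \<sigma> G
      = (\<Sum>v\<in>X1. vertex_imbalance v \<sigma> G) + (\<Sum>v\<in>X2. vertex_imbalance v \<sigma> G)
        + (\<Sum>v\<in>X0. vertex_imbalance v \<sigma> G) + (\<Sum>v\<in>Y. vertex_imbalance v \<sigma> G)"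
    unfolding ordering_imbalance_def V sum.union_disjoint[OF fin disj]
    by (subst X) (use disjX finX in \<open>simp add: sum.union_disjoint\<close>)
  also have "\<dots> = 2 * (m div 2) * n + (m mod 2) * (n mod 2) + n * (m mod 2)"
    by (simp add: imb_X1 imb_X2 imb_X0 imb_Y X1 X2 X0 n_def)
  also have "\<dots> = (2 * (m div 2) + m mod 2) * n + (m mod 2) * (n mod 2)"
    by (simp only: algebra_simps)
  also have "2 * (m div 2) + m mod 2 = m" by simp
  finally have "ordering_imbalance \<sigma> G = m * n + (m mod 2) * (n mod 2)" .
  with \<sigma> show ?thesis by (intro that[of \<sigma>]) (simp_all add: m_def n_def)
qed

theorem theorem1:
  fixes G :: "('a, 'b) pre_digraph" and X Y :: "'a set"
  assumes "connected G"
    and "complete_bipartite_graph G X Y"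
  shows "imbalance G = card X * card Y + (card X mod 2) * (card Y mod 2)"
proof -
  interpret graph G using assms by (simp add: complete_bipartite_graph_def)
  obtain \<sigma> where "is_ordering (verts G) \<sigma>"
    and "ordering_imbalance \<sigma> G = card X * card Y + (card X mod 2) * (card Y mod 2)"
    using ordering_imbalance_attained[OF assms(2)] .
  then show ?thesis
    unfolding imbalance_def
    using ordering_imbalance_lower_bound[OF assms(2)] finite_ordering_imbalances
    by (intro Min_eqI) force+
qed

end
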